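(* Let $m$ be an odd square-free positive integer, and let $p,p'$ be primes with $p>m$, $p'>m$ and $p\equiv p'\pmod m$. Then $g(\Phi_{mp})=g(\Phi_{mp'})$.
   Context: $\Phi_N(x)=\prod_{1\le j\le N,\ \gcd(j,N)=1}(x-e^{2\pi i j/N})$ is the $N$-th cyclotomic polynomial. For a polynomial $f=c_1x^{\nu_1}+\cdots+c_tx^{\nu_t}$ with all $c_i\ne0$, $0\le\nu_1<\cdots<\nu_t$, the maximum gap is $g(f)=\max_{1\le i<t}(\nu_{i+1}-\nu_i)$ if $t\ne1$ and $g(f)=0$ if $t=1$. *)

theory Defs
  imports Complex_Main "HOL-Computational_Algebra.Computational_Algebra"
begin

definition cyclotomic :: "nat \<Rightarrow> complex poly" where
  "cyclotomic N =
     (\<Prod>j | 1 \<le> j \<and> j \<le> N \<and> coprime j N.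
        [:- exp (2 * complex_of_real pi * \<i> * of_nat j / of_nat N), 1:])"

text \<open>The increasing list of the exponents of the nonzero terms. For a nonzero polynomial
  this is \<open>[\<nu>\<^sub>1, \<dots>, \<nu>\<^sub>t]\<close>, shifted to indices \<open>0, \<dots>, t - 1\<close>; it is empty for the zero polynomial.\<close>

definition exponents :: "'a::zero poly \<Rightarrow> nat list" where
  "exponents f = sorted_list_of_set {n. coeff f n \<noteq> 0}"

text \<open>Truncated subtraction is harmless here, because the list is strictly increasing. The zero
  polynomial (no terms) is given the value \<open>0\<close> by convention.\<close>

definition max_gap :: "'a::zero poly \<Rightarrow> nat" where
  "max_gap f =
     (let \<nu> = exponents f; t = length \<nu>
      in if t \<le> 1 then 0 else Max {\<nu> ! Suc i - \<nu> ! i | i. Suc i < t})"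

end

theory Submission
  imports Defs "HOL-Number_Theory.Totient" "HOL-Analysis.Complex_Transcendental"
begin

text \<open>Cut the exponents of \<open>\<Phi>\<^sub>m\<^sub>p\<close> into blocks \<open>[i p, (i + 1) p)\<close> with \<open>i < \<phi>(m)\<close>. Since
  \<open>\<Phi>\<^sub>m\<^sub>p(x) = \<Phi>\<^sub>m(x\<^sup>p) / \<Phi>\<^sub>m(x)\<close> and \<open>1 / \<Phi>\<^sub>m\<close> has \<open>m\<close>-periodic coefficients, block \<open>i\<close> is an initial
  piece of length \<open>p\<close> of an \<open>m\<close>-periodic sequence that depends only on \<open>p mod m\<close>. This sequence is
  nonzero and satisfies the linear recurrence of order \<open>\<phi>(m)\<close> given by \<open>\<Phi>\<^sub>m\<close>, hence never has \<open>\<phi>(m)\<close>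
  consecutive zeros. So a gap inside a block is at most \<open>\<phi>(m)\<close>, a value which is attained in block \<open>0\<close>
  just before the exponent \<open>m\<close>, while a gap across the border of two blocks stays within \<open>\<phi>(m)\<close> of
  that border and is therefore determined by \<open>p mod m\<close>.\<close>

subsection \<open>Roots of cyclotomic polynomials\<close>

definition unit_root :: "nat \<Rightarrow> nat \<Rightarrow> complex" where
  "unit_root N j = exp (2 * complex_of_real pi * \<i> * of_nat j / of_nat N)"

definition primitive_roots :: "nat \<Rightarrow> complex set" where
  "primitive_roots N = unit_root N ` totatives N"

lemma unit_root_eq_iff: "N > 0 \<Longrightarrow> unit_root N j = unit_root N k \<longleftrightarrow> j mod N = k mod N"
  using complex_root_unity_eq[of N j k] by (simp add: unit_root_def)

lemma unit_root_power: "unit_root N j ^ k = unit_root N (j * k)"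
  by (simp add: unit_root_def exp_of_nat_mult [symmetric] mult_ac)

lemma unit_root_mult_power: "p > 0 \<Longrightarrow> unit_root (N * p) j ^ p = unit_root N j"
  by (simp add: unit_root_def exp_of_nat_mult [symmetric] field_simps)

lemma unit_root_self: "unit_root N N = 1"
  by (cases "N = 0") (auto simp: unit_root_def)

lemma unit_root_nonzero: "unit_root N j \<noteq> 0"
  by (simp add: unit_root_def)

lemma unit_root_in_primitive_roots:
  assumes "N > 0" "coprime j N"
  shows "unit_root N j \<in> primitive_roots N"
\<comment> \<open>The representative \<open>j mod N\<close> is a totative except for
  \<open>N = 1\<close>, where it is 0 while the only totative is 1.\<close>
proof (cases "N = 1")
  case True
  have "unit_root N j = unit_root N 1"
    using True by (subst unit_root_eq_iff) auto
  then show ?thesis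
    using True by (simp add: primitive_roots_def)
next
  case False
  have "coprime (j mod N) N"
    using assms by (simp add: coprime_commute)
  moreover have "j mod N \<noteq> 0"
    using calculation False by (metis coprime_0_left_iff nat_dvd_1_iff_1)
  ultimately have "j mod N \<in> totatives N"
    using assms by (auto simp: in_totatives_iff intro: less_imp_le)
  moreover have "unit_root N j = unit_root N (j mod N)"
    using assms by (subst unit_root_eq_iff) auto
  ultimately show ?thesis
    by (auto simp: primitive_roots_def)
qed

lemma inj_on_unit_root: "inj_on (unit_root N) (totatives N)"
proof (cases "N > 1")
  case True
  then show ?thesis
    by (auto simp: inj_on_def unit_root_eq_iff dest!: totatives_less)
next
  case False
  then have "N = 0 \<or> N = 1" by auto
  then show ?thesis by auto
qed

lemma finite_primitive_roots [simp]: "finite (primitive_roots N)"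
  by (simp add: primitive_roots_def)

lemma card_primitive_roots: "card (primitive_roots N) = totient N"
  unfolding primitive_roots_def by (simp add: card_image inj_on_unit_root totient_def)

lemma primitive_root_power_eq_1: "z \<in> primitive_roots N \<Longrightarrow> z ^ N = 1"
  by (auto simp: primitive_roots_def unit_root_power)
     (metis mult.commute power_one unit_root_power unit_root_self)

lemma primitive_root_power:
  assumes "coprime p N" "z \<in> primitive_roots N"
  shows "z ^ p \<in> primitive_roots N"
  using assms unit_root_in_primitive_roots
  by (auto simp: primitive_roots_def unit_root_power in_totatives_iff coprime_commute)

lemma inj_on_primitive_root_power:
  assumes "coprime p N"
  shows "inj_on (\<lambda>z. z ^ p) (primitive_roots N)"
proof (rule inj_onI)
  fix z w assume "z \<in> primitive_roots N" "w \<in> primitive_roots N" and eq: "z ^ p = w ^ p"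
  then obtain j k where jk: "z = unit_root N j" "w = unit_root N k" "N > 0"
    by (auto simp: primitive_roots_def in_totatives_iff)
  have "[j * p = k * p] (mod N)"
    using eq jk by (simp add: unit_root_power unit_root_eq_iff cong_def)
  then have "[j = k] (mod N)"
    using assms cong_mult_rcancel_nat by (metis coprime_commute)
  then show "z = w"
    using jk by (simp add: unit_root_eq_iff cong_def)
qed

section \<open>Cyclotomic polynomials as products over primitive roots\<close>

lemma cyclotomic_eq_prod: "cyclotomic N = (\<Prod>z\<in>primitive_roots N. [:- z, 1:])"
proof -
  have "{j. 1 \<le> j \<and> j \<le> N \<and> coprime j N} = totatives N"
    by (auto simp: totatives_def)
  then show ?thesis
    unfolding cyclotomic_def primitive_roots_def
    by (subst prod.reindex[OF inj_on_unit_root]) (simp add: unit_root_def)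
qed

lemma degree_cyclotomic: "degree (cyclotomic N) = totient N"
  unfolding cyclotomic_eq_prod
  by (subst degree_prod_sum_eq) (auto simp: card_primitive_roots)

lemma lead_coeff_cyclotomic: "coeff (cyclotomic N) (totient N) = 1"
proof -
  have "lead_coeff (cyclotomic N) = 1"
    unfolding cyclotomic_eq_prod lead_coeff_prod by simp
  then show ?thesis by (simp add: degree_cyclotomic)
qed

lemma poly_cyclotomic_eq_0_iff: "poly (cyclotomic N) z = 0 \<longleftrightarrow> z \<in> primitive_roots N"
  by (auto simp: cyclotomic_eq_prod poly_prod)

text \<open>Roots of unity are nonzero. This makes \<open>cyclotomic N\<close> invertible as a power
  series and lets its recurrence be solved for the latest term.\<close>

lemma coeff_0_cyclotomic: "coeff (cyclotomic N) 0 \<noteq> 0"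
proof -
  have "0 \<notin> primitive_roots N"
    by (metis imageE primitive_roots_def unit_root_nonzero)
  then show ?thesis
    using poly_cyclotomic_eq_0_iff[of N 0] by (simp add: poly_0_coeff_0)
qed

lemma prod_linear_factors_dvd:
  fixes f :: "'a::idom poly"
  assumes "finite S" "\<And>z. z \<in> S \<Longrightarrow> poly f z = 0"
  shows "(\<Prod>z\<in>S. [:- z, 1:]) dvd f"
  using assms
proof (induction S arbitrary: f rule: finite_induct)
  case empty
  then show ?case by simp
next
  case (insert a S)
  obtain g where g: "f = [:- a, 1:] * g"
    using insert.prems[of a] by (auto simp: poly_eq_0_iff_dvd dvd_def)
  have "poly g z = 0" if "z \<in> S" for z
    using insert.prems[of z] insert.hyps that by (auto simp: g)
  then have "(\<Prod>z\<in>S. [:- z, 1:]) dvd g"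
    by (rule insert.IH)
  then show ?case
    using insert.hyps g mult_dvd_mono[OF dvd_refl, of _ g "[:- a, 1:]"] by simp
qed

lemma cyclotomic_dvd: "cyclotomic N dvd monom 1 N - 1"
  unfolding cyclotomic_eq_prod
  by (rule prod_linear_factors_dvd) (auto simp: poly_monom primitive_root_power_eq_1)

section \<open>The factorization of Phi_m(x^p)\<close>

lemma primitive_roots_mult_prime:
  assumes "prime p" "coprime p m" "m > 0" "z \<in> primitive_roots (m * p)"
  shows "z ^ p \<in> primitive_roots m" "z \<notin> primitive_roots m"
proof -
  obtain j where j: "z = unit_root (m * p) j" "coprime j (m * p)"
    using assms by (auto simp: primitive_roots_def in_totatives_iff)
  have p: "p > 0" using assms(1) prime_gt_0_nat by blast
  show "z ^ p \<in> primitive_roots m"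
    using j assms p by (auto simp: unit_root_mult_power intro: unit_root_in_primitive_roots)
  show "z \<notin> primitive_roots m"
  proof
    assume "z \<in> primitive_roots m"
    then have "unit_root (m * p) (j * m) = unit_root (m * p) 0"
      using primitive_root_power_eq_1[of z m] j(1) unit_root_power[of "m * p" j m]
      by (simp add: unit_root_def)
    \<comment> \<open>From \<open>z ^ m = 1\<close>; cancelling \<open>m\<close> gives
      \<open>p dvd j\<close>, against \<open>coprime j (m * p)\<close>.\<close>
    then have "m * p dvd j * m"
      using assms p by (simp add: unit_root_eq_iff dvd_eq_mod_eq_0)
    then have "p dvd j"
      using assms by (simp add: mult.commute)
    then show False
      using j assms(1) by (metis coprime_common_divisor coprime_mult_right_iff dvd_refl not_prime_unit)
  qed
qed

lemma degree_pcompose_monom: "degree (pcompose f (monom (1::complex) p)) = degree f * p"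
  by (simp add: degree_pcompose degree_monom_eq)

text \<open>Both sides are monic of degree \<open>totient m * p\<close> and vanish on the disjoint
  union of the primitive roots of orders \<open>m * p\<close> and \<open>m\<close>, which has
  exactly that many elements.\<close>

lemma cyclotomic_mult_prime:
  assumes "prime p" "coprime p m" "m > 0"
  shows "cyclotomic (m * p) * cyclotomic m = pcompose (cyclotomic m) (monom 1 p)" (is "?L = ?R")
proof (rule poly_eqI_degree_lead_coeff)
  let ?n = "totient m * p" and ?A = "primitive_roots (m * p) \<union> primitive_roots m"
  have p: "p > 0" using assms(1) prime_gt_0_nat by blast
  have "totient (m * p) = totient m * (p - 1)"
    using assms by (simp add: totient_mult_coprime coprime_commute totient_prime)
  then have tot: "totient (m * p) + totient m = ?n"
    using p by (cases p) simp_all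
  have nz: "cyclotomic N \<noteq> 0" for N
    using coeff_0_cyclotomic[of N] by auto
  have degL: "degree ?L = ?n"
    by (simp add: degree_mult_eq nz degree_cyclotomic tot)
  have degR: "degree ?R = ?n"
    by (simp add: degree_pcompose_monom degree_cyclotomic)
  have "lead_coeff ?L = 1"
    unfolding lead_coeff_mult by (simp add: degree_cyclotomic lead_coeff_cyclotomic)
  moreover have "lead_coeff ?R = 1"
    using p by (subst lead_coeff_comp)
      (auto simp: degree_cyclotomic lead_coeff_cyclotomic degree_monom_eq)
  ultimately show "coeff ?L ?n = coeff ?R ?n"
    by (simp add: degL degR)
  have "primitive_roots (m * p) \<inter> primitive_roots m = {}"
    using primitive_roots_mult_prime(2)[OF assms] by auto
  then show "?n \<le> card ?A"
    by (simp add: card_Un_disjoint card_primitive_roots tot)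
  show "degree ?L \<le> ?n" "degree ?R \<le> ?n"
    by (simp_all add: degL degR)
  show "poly ?L z = poly ?R z" if "z \<in> ?A" for z
  proof -
    have "z ^ p \<in> primitive_roots m"
      using that primitive_roots_mult_prime(1)[OF assms] primitive_root_power[OF assms(2)] by blast
    then have "poly ?R z = 0"
      by (simp add: poly_pcompose poly_monom poly_cyclotomic_eq_0_iff)
    moreover have "poly ?L z = 0"
      using that by (auto simp: poly_cyclotomic_eq_0_iff)
    ultimately show ?thesis by simp
  qed
qed

subsection \<open>The blocks of coefficients\<close>

definition inv_coeff :: "nat \<Rightarrow> nat \<Rightarrow> complex" where
  "inv_coeff m n = fps_nth (inverse (fps_of_poly (cyclotomic m))) n"

lemma inverse_cyclotomic: "inverse (fps_of_poly (cyclotomic m)) * fps_of_poly (cyclotomic m) = 1"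
  by (rule inverse_mult_eq_1) (simp add: coeff_0_cyclotomic)

text \<open>The witness \<open>\<psi>\<close> below is the inverse cyclotomic polynomial \<open>(x\<^sup>m - 1) / \<Phi>\<^sub>m\<close>; as
  \<open>1 / \<Phi>\<^sub>m = - \<psi> (1 + x\<^sup>m + x\<^sup>2\<^sup>m + \<dots>)\<close> and \<open>deg \<psi> < m\<close>, the coefficients of \<open>1 / \<Phi>\<^sub>m\<close> repeat
  those of \<open>- \<psi>\<close> periodically.\<close>

lemma inverse_cyclotomic_coeffs:
  assumes "m > 0"
  obtains \<psi> where "degree \<psi> = m - totient m" "\<psi> \<noteq> 0"
    "\<And>n. n < m \<Longrightarrow> inv_coeff m n = - coeff \<psi> n"
    "\<And>n. inv_coeff m (n + m) = inv_coeff m n"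
proof -
  let ?C = "inverse (fps_of_poly (cyclotomic m))"
  obtain \<psi> where \<psi>: "monom 1 m - 1 = cyclotomic m * \<psi>"
    using cyclotomic_dvd[of m] by (auto simp: dvd_def)
  have deg1: "degree (monom 1 m - 1 :: complex poly) = m"
    using assms degree_add_eq_left[of "- 1 :: complex poly" "monom 1 m"]
    by (simp add: degree_monom_eq)
  then have nz: "\<psi> \<noteq> 0" "cyclotomic m \<noteq> 0"
    using \<psi> assms by auto
  have "totient m + degree \<psi> = m"
    using deg1 nz unfolding \<psi> by (simp add: degree_mult_eq degree_cyclotomic)
  then have deg: "degree \<psi> = m - totient m" by simp
  have "degree \<psi> < m"
    using deg assms totient_gt_0_iff[of m] by linarith
  have "fps_X ^ m - 1 = fps_of_poly (cyclotomic m) * fps_of_poly \<psi>"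
    using arg_cong[OF \<psi>, of fps_of_poly]
    by (simp add: fps_of_poly_diff fps_of_poly_mult fps_of_poly_monom)
  then have "?C * (fps_X ^ m - 1) = (?C * fps_of_poly (cyclotomic m)) * fps_of_poly \<psi>"
    by (simp add: mult.assoc)
  then have eq: "?C * (fps_X ^ m - 1) = fps_of_poly \<psi>"
    by (simp add: inverse_cyclotomic)
  have nth: "coeff \<psi> n = (if n < m then 0 else inv_coeff m (n - m)) - inv_coeff m n" for n
    using arg_cong[OF eq [symmetric], of "\<lambda>f. fps_nth f n"]
    by (simp add: right_diff_distrib fps_X_power_mult_right_nth inv_coeff_def)
  show ?thesis
  proof
    show "inv_coeff m n = - coeff \<psi> n" if "n < m" for n
      using nth[of n] that by simp
    show "inv_coeff m (n + m) = inv_coeff m n" for n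
      using nth[of "n + m"] \<open>degree \<psi> < m\<close> by (simp add: coeff_eq_0)
  qed (use deg nz in auto)
qed

lemma inv_coeff_mod:
  assumes "m > 0"
  shows "inv_coeff m (n mod m) = inv_coeff m n"
proof -
  have period: "inv_coeff m (n + m) = inv_coeff m n" for n
    by (rule inverse_cyclotomic_coeffs[OF assms])
  have "inv_coeff m (n + k * m) = inv_coeff m n" for n k
  proof (induction k)
    case (Suc k)
    then show ?case
      using period[of "n + k * m"] by (simp add: ac_simps)
  qed simp
  from this[of "n mod m" "n div m"] show ?thesis by simp
qed

text \<open>This compares coefficients of x^n in Phi_m * (1 / Phi_m) = 1.\<close>

lemma inv_coeff_recurrence:
  assumes "n > 0"
  shows "(\<Sum>k\<le>n. coeff (cyclotomic m) k * inv_coeff m (n - k)) = 0"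
proof -
  have "fps_nth (fps_of_poly (cyclotomic m) * inverse (fps_of_poly (cyclotomic m))) n = 0"
    using inverse_cyclotomic[of m] assms by (simp add: mult.commute)
  then show ?thesis
    by (simp add: fps_mult_nth inv_coeff_def atMost_atLeast0)
qed

section \<open>Blocks as periodic recurrent sequences\<close>

text \<open>The index \<open>s\<close> is not confined to \<open>s < p\<close>: the whole infinite
  sequence is kept, so that periodicity and the recurrence hold without boundary cases.\<close>

definition block :: "nat \<Rightarrow> nat \<Rightarrow> nat \<Rightarrow> nat \<Rightarrow> complex" where
  "block m p i s = (\<Sum>k\<le>i. coeff (cyclotomic m) k * inv_coeff m ((i - k) * p + s))"

lemma block_cong:
  assumes "m > 0" "[p = p'] (mod m)" "[s = s'] (mod m)"
  shows "block m p i s = block m p' i s'"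
proof -
  have "inv_coeff m ((i - k) * p + s) = inv_coeff m ((i - k) * p' + s')" for k
    using assms(2,3) inv_coeff_mod[OF assms(1)]
    by (metis cong_add cong_def cong_refl cong_mult)
  then show ?thesis by (simp add: block_def)
qed

text \<open>A block is a fixed linear combination of shifts of \<open>inv_coeff m\<close>, and each
  shift satisfies the recurrence.\<close>

lemma block_recurrence:
  assumes "m > 0"
  shows "(\<Sum>k\<le>totient m. coeff (cyclotomic m) k * block m p i (s + totient m - k)) = 0"
proof -
  let ?a = "coeff (cyclotomic m)" and ?\<phi> = "totient m"
  \<comment> \<open>The index \<open>t + ?\<phi>\<close> is positive because \<open>m > 0\<close>,
    so the constant term 1 of the product is never met.\<close>
  have c: "(\<Sum>k\<le>?\<phi>. ?a k * inv_coeff m (t + ?\<phi> - k)) = 0" for t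
  proof -
    have "(\<Sum>k\<le>?\<phi>. ?a k * inv_coeff m (t + ?\<phi> - k)) = (\<Sum>k\<le>t + ?\<phi>. ?a k * inv_coeff m (t + ?\<phi> - k))"
      by (rule sum.mono_neutral_left) (auto simp: coeff_eq_0 degree_cyclotomic)
    then show ?thesis
      using assms by (simp add: inv_coeff_recurrence)
  qed
  have "(\<Sum>k\<le>?\<phi>. ?a k * block m p i (s + ?\<phi> - k)) =
      (\<Sum>k\<le>?\<phi>. \<Sum>l\<le>i. ?a l * (?a k * inv_coeff m (((i - l) * p + s) + ?\<phi> - k)))"
    unfolding block_def sum_distrib_left
    by (intro sum.cong refl) (simp add: add.assoc mult.left_commute)
  also have "\<dots> = (\<Sum>l\<le>i. ?a l * (\<Sum>k\<le>?\<phi>. ?a k * inv_coeff m (((i - l) * p + s) + ?\<phi> - k)))"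
    by (subst sum.swap) (simp add: sum_distrib_left)
  also have "\<dots> = 0"
    by (simp add: c)
  finally show ?thesis .
qed

text \<open>The recurrence has order \<open>totient m\<close> and an invertible coefficient at the
  newest term, so zeros propagate forward from the window; periodicity carries them back to indices
  before \<open>u\<close>.\<close>

lemma block_eq_0_if_window:
  assumes "m > 0" and window: "\<And>s. u \<le> s \<Longrightarrow> s < u + totient m \<Longrightarrow> block m p i s = 0"
  shows "block m p i s = 0"
proof -
  let ?a = "coeff (cyclotomic m)" and ?\<phi> = "totient m"
  have later: "block m p i s = 0" if "u \<le> s" for s
    using that
  proof (induction s rule: less_induct)
    case (less s)
    show ?case
    proof (cases "s < u + ?\<phi>")
      case True
      then show ?thesis using window less.prems by auto
    next
      case False
      define t where "t = s - ?\<phi>"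
      have t: "s = t + ?\<phi>" "u \<le> t"
        using False by (auto simp: t_def)
      have "0 = (\<Sum>k\<le>?\<phi>. ?a k * block m p i (t + ?\<phi> - k))"
        using block_recurrence[OF assms(1)] by simp
      also have "\<dots> = ?a 0 * block m p i s + (\<Sum>k\<in>{..?\<phi>} - {0}. ?a k * block m p i (t + ?\<phi> - k))"
        by (subst sum.remove[of _ 0]) (auto simp: t)
      also have "(\<Sum>k\<in>{..?\<phi>} - {0}. ?a k * block m p i (t + ?\<phi> - k)) = 0"
        using t by (intro sum.neutral) (auto intro!: less.IH)
      finally show ?thesis
        using coeff_0_cyclotomic[of m] by simp
    qed
  qed
  \<comment> \<open>Since \<open>m > 0\<close>, a shift by \<open>u\<close> periods moves any
    \<open>s\<close> to or beyond \<open>u\<close>.\<close>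
  have "block m p i s = block m p i (s + u * m)"
    using assms(1) by (intro block_cong) (auto simp: cong_def)
  also have "\<dots> = 0"
    using assms(1) by (intro later) (simp add: trans_le_add2)
  finally show ?thesis .
qed

section \<open>Blocks as coefficients of Phi_mp\<close>

text \<open>The factor x^(kp) shifts by \<open>k * p\<close>, and as \<open>s < p\<close> only
  \<open>k \<le> i\<close> contributes. The cutoff \<open>d\<close> serves two uses:
  \<open>d = totient m\<close> gives Phi_m(x^p), smaller \<open>d\<close> its truncations.\<close>

lemma fps_nth_spread_mult_inverse:
  assumes "s < p"
  shows "fps_nth (fps_of_poly (\<Sum>k\<le>d. monom (coeff (cyclotomic m) k) (k * p)) *
      inverse (fps_of_poly (cyclotomic m))) (i * p + s) =
    (\<Sum>k\<le>min d i. coeff (cyclotomic m) k * inv_coeff m ((i - k) * p + s))" (is "?lhs = _")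
proof -
  let ?a = "coeff (cyclotomic m)"
  have le: "k * p \<le> i * p + s \<longleftrightarrow> k \<le> i" for k
  proof
    assume "k * p \<le> i * p + s"
    then have "k * p < Suc i * p" using assms by simp
    then show "k \<le> i" by (simp only: mult_less_cancel2) auto
  qed (simp add: trans_le_add1)
  have mon: "fps_of_poly (monom c n) = fps_const c * fps_X ^ n" for c :: complex and n
    by (simp add: fps_of_poly_monom)
  have le': "i * p + s < k * p \<longleftrightarrow> \<not> k \<le> i" for k
    using le[of k] by linarith
  have "?lhs = (\<Sum>k\<le>d. if k \<le> i then ?a k * inv_coeff m (i * p + s - k * p) else 0)"
    unfolding fps_of_poly_sum mon
    by (simp add: sum_distrib_right fps_sum_nth mult.assoc fps_X_power_mult_nth le' inv_coeff_def
        if_distrib cong: if_cong) (intro sum.cong; simp)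
  also have "\<dots> = (\<Sum>k\<in>{k\<in>{..d}. k \<le> i}. ?a k * inv_coeff m (i * p + s - k * p))"
    by (rule sum.inter_filter [symmetric]) simp
  also have "{k\<in>{..d}. k \<le> i} = {..min d i}"
    by auto
  also have "(\<Sum>k\<le>min d i. ?a k * inv_coeff m (i * p + s - k * p)) =
      (\<Sum>k\<le>min d i. ?a k * inv_coeff m ((i - k) * p + s))"
    by (intro sum.cong) (auto simp: diff_mult_distrib)
  finally show ?thesis .
qed

lemma coeff_cyclotomic_mult_prime:
  assumes "prime p" "coprime p m" "m > 0" "s < p"
  shows "coeff (cyclotomic (m * p)) (i * p + s) = block m p i s"
proof -
  let ?A = "fps_of_poly (cyclotomic m)" and ?a = "coeff (cyclotomic m)" and ?\<phi> = "totient m"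
  let ?S = "\<Sum>k\<le>?\<phi>. monom (?a k) (k * p)"
  have "pcompose (cyclotomic m) (monom 1 p) = ?S"
    by (rule poly_eq_poly_eq_iff[THEN iffD1], rule ext)
      (simp add: poly_pcompose poly_monom poly_sum poly_altdef[of "cyclotomic m"] degree_cyclotomic
        mult.commute[of _ p] power_mult)
  then have "fps_of_poly (cyclotomic (m * p)) * ?A = fps_of_poly ?S"
    using cyclotomic_mult_prime[OF assms(1-3)] by (simp flip: fps_of_poly_mult)
  then have "fps_of_poly ?S * inverse ?A = fps_of_poly (cyclotomic (m * p)) * (inverse ?A * ?A)"
    by (metis mult.assoc mult.commute)
  then have "fps_of_poly (cyclotomic (m * p)) = fps_of_poly ?S * inverse ?A"
    by (simp add: inverse_cyclotomic)
  from arg_cong[OF this, of "\<lambda>f. fps_nth f (i * p + s)"]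
  have "coeff (cyclotomic (m * p)) (i * p + s) =
      (\<Sum>k\<le>min ?\<phi> i. ?a k * inv_coeff m ((i - k) * p + s))"
    using fps_nth_spread_mult_inverse[OF assms(4)] by simp
  also have "\<dots> = block m p i s"
    unfolding block_def
    by (rule sum.mono_neutral_left) (auto simp: coeff_eq_0 degree_cyclotomic)
  finally show ?thesis .
qed

text \<open>If block \<open>i\<close> vanished, \<open>\<Phi>\<^sub>m\<close> would divide \<open>B(x\<^sup>p)\<close>, where \<open>B\<close> is the truncation of
  \<open>\<Phi>\<^sub>m\<close> to degree \<open>i\<close>; then \<open>B\<close> would vanish at all \<open>\<phi>(m) > i\<close> primitive roots.\<close>

lemma block_nonzero:
  assumes "coprime p m" "m > 0" "p > 0" "i < totient m"
  shows "\<exists>s. block m p i s \<noteq> 0"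
proof (rule ccontr)
  assume "\<not> ?thesis"
  then have zero: "block m p i s = 0" for s by simp
  let ?a = "coeff (cyclotomic m)" and ?A = "fps_of_poly (cyclotomic m)"
  define S where "S = (\<Sum>k\<le>i. monom (?a k) (k * p))"
  define B where "B = (\<Sum>k\<le>i. monom (?a k) k)"
  define F where "F = fps_of_poly S * inverse ?A"
  \<comment> \<open>Vanishing of block \<open>i\<close> turns the power series \<open>F\<close> into
    a polynomial of degree below \<open>i * p\<close>, namely \<open>Q\<close>.\<close>
  have F0: "fps_nth F n = 0" if "i * p \<le> n" for n
  proof -
    define j s where "j = n div p" and "s = n mod p"
    have n: "n = j * p + s" "s < p"
      using assms by (auto simp: j_def s_def)
    have "i \<le> j"
      using that assms by (simp add: j_def less_eq_div_iff_mult_less_eq)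
    have "fps_nth F n = (\<Sum>k\<le>i. ?a k * inv_coeff m ((j - k) * p + s))"
      using fps_nth_spread_mult_inverse[OF n(2), of m i j] \<open>i \<le> j\<close>
      by (simp add: F_def S_def n(1) min_absorb1)
    \<comment> \<open>After truncation at \<open>i\<close>, every later block \<open>j\<close> is a
      continuation of block \<open>i\<close>, read \<open>(j - i) * p\<close> places further
      on.\<close>
    also have "\<dots> = block m p i ((j - i) * p + s)"
      unfolding block_def
    proof (intro sum.cong arg_cong2[of _ _ _ _ "(*)"] refl arg_cong[of _ _ "inv_coeff m"])
      fix k assume "k \<in> {..i}"
      then have "j - k = (i - k) + (j - i)" using \<open>i \<le> j\<close> by auto
      then show "(j - k) * p + s = (i - k) * p + ((j - i) * p + s)"
        by (simp add: algebra_simps)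
    qed
    finally show ?thesis using zero by simp
  qed
  define Q where "Q = (\<Sum>n<i * p. monom (fps_nth F n) n)"
  have "fps_of_poly Q = F"
  proof (rule fps_ext)
    fix n
    have "coeff Q n = (\<Sum>k<i * p. if k = n then fps_nth F k else 0)"
      by (simp add: Q_def coeff_sum)
    also have "\<dots> = fps_nth F n"
      using F0 by (auto simp: sum.delta)
    finally show "fps_nth (fps_of_poly Q) n = fps_nth F n" by simp
  qed
  then have "fps_of_poly (Q * cyclotomic m) = fps_of_poly S"
    by (simp add: fps_of_poly_mult F_def mult.assoc inverse_cyclotomic)
  then have SQ: "S = Q * cyclotomic m" by simp
  have "poly B w = 0" if w: "w \<in> (\<lambda>z. z ^ p) ` primitive_roots m" for w
  proof -
    obtain z where z: "w = z ^ p" "z \<in> primitive_roots m" using w by auto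
    have "poly B w = poly S z"
      by (simp add: B_def S_def poly_sum poly_monom z mult.commute[of _ p] power_mult)
    then show ?thesis
      using z poly_cyclotomic_eq_0_iff[of m z] by (simp add: SQ)
  qed
  moreover have "card ((\<lambda>z. z ^ p) ` primitive_roots m) = totient m"
    using assms by (simp add: card_image inj_on_primitive_root_power card_primitive_roots)
  moreover have "degree B \<le> i"
    unfolding B_def by (intro degree_sum_le) (auto intro: order.trans[OF degree_monom_le])
  \<comment> \<open>\<open>B\<close> has \<open>totient m\<close> distinct roots, more than its
    degree, which is at most \<open>i\<close>.\<close>
  ultimately have "B = 0"
    using assms by (intro poly_eqI_degree[of "(\<lambda>z. z ^ p) ` primitive_roots m"]) auto
  moreover have "coeff B 0 = ?a 0"
    by (simp add: B_def coeff_sum sum.delta if_distrib cong: if_cong)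
  ultimately show False
    using coeff_0_cyclotomic[of m] by simp
qed

subsection \<open>Gaps\<close>

text \<open>Gaps are described by coefficients alone, without list positions, so that they can be
  carried from one polynomial to another.\<close>

definition is_gap :: "'a::zero poly \<Rightarrow> nat \<Rightarrow> nat \<Rightarrow> bool" where
  "is_gap f a b \<longleftrightarrow> a < b \<and> coeff f a \<noteq> 0 \<and> coeff f b \<noteq> 0 \<and> (\<forall>n. a < n \<and> n < b \<longrightarrow> coeff f n = 0)"

lemma finite_support: "finite {n. coeff f n \<noteq> 0}"
  by (rule finite_subset[of _ "{..degree f}"]) (auto intro: le_degree)

lemma set_exponents: "set (exponents f) = {n. coeff f n \<noteq> 0}"
  by (simp add: exponents_def finite_support)

lemma exponents_less_iff:
  "i < length (exponents f) \<Longrightarrow> j < length (exponents f) \<Longrightarrow>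
    exponents f ! i < exponents f ! j \<longleftrightarrow> i < j"
  unfolding exponents_def
  by (metis linorder_neqE_nat order_less_asym sorted_wrt_nth_less strict_sorted_list_of_set)

lemma is_gap_iff_exponents:
  "is_gap f a b \<longleftrightarrow>
    (\<exists>i. Suc i < length (exponents f) \<and> a = exponents f ! i \<and> b = exponents f ! Suc i)"
proof
  assume gap: "is_gap f a b"
  then have "a \<in> set (exponents f)" "b \<in> set (exponents f)"
    by (auto simp: set_exponents is_gap_def)
  then obtain i j where ij: "i < length (exponents f)" "a = exponents f ! i"
      "j < length (exponents f)" "b = exponents f ! j"
    by (metis in_set_conv_nth)
  have "i < j"
    using gap ij exponents_less_iff[of i f j] by (simp add: is_gap_def)
  moreover have "\<not> Suc i < j"
  proof
    assume *: "Suc i < j"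
    then have "a < exponents f ! Suc i" "exponents f ! Suc i < b"
      using ij by (auto simp: exponents_less_iff)
    moreover have "coeff f (exponents f ! Suc i) \<noteq> 0"
      using * ij nth_mem[of "Suc i" "exponents f"] by (simp add: set_exponents)
    ultimately show False
      using gap by (auto simp: is_gap_def)
  qed
  ultimately have "j = Suc i" by simp
  then show "\<exists>i. Suc i < length (exponents f) \<and> a = exponents f ! i \<and> b = exponents f ! Suc i"
    using ij by auto
next
  assume "\<exists>i. Suc i < length (exponents f) \<and> a = exponents f ! i \<and> b = exponents f ! Suc i"
  then obtain i where i: "Suc i < length (exponents f)" "a = exponents f ! i" "b = exponents f ! Suc i"
    by blast
  have "coeff f n = 0" if "a < n" "n < b" for n
  proof (rule ccontr)
    assume "coeff f n \<noteq> 0"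
    then obtain k where "k < length (exponents f)" "n = exponents f ! k"
      by (metis (mono_tags, lifting) in_set_conv_nth mem_Collect_eq set_exponents)
    then show False
      using that i exponents_less_iff[of i f k] exponents_less_iff[of k f "Suc i"] by simp
  qed
  moreover have "a < b"
    using i by (simp add: exponents_less_iff)
  moreover have "coeff f a \<noteq> 0" "coeff f b \<noteq> 0"
    using i nth_mem[of i "exponents f"] nth_mem[of "Suc i" "exponents f"]
    by (auto simp: set_exponents)
  ultimately show "is_gap f a b"
    by (simp add: is_gap_def)
qed

lemma finite_gaps:
  "finite {exponents f ! Suc i - exponents f ! i | i. Suc i < length (exponents f)}"
  by (rule finite_subset[of _ "(\<lambda>i. exponents f ! Suc i - exponents f ! i) ` {..<length (exponents f)}"])
    auto

lemma max_gap_ge: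
  assumes "is_gap f a b"
  shows "b - a \<le> max_gap f"
proof -
  obtain i where i: "Suc i < length (exponents f)" "a = exponents f ! i" "b = exponents f ! Suc i"
    using assms by (auto simp: is_gap_iff_exponents)
  then show ?thesis
    using finite_gaps[of f] unfolding max_gap_def Let_def by (auto intro!: Max_ge)
qed

lemma max_gap_le:
  assumes "\<And>a b. is_gap f a b \<Longrightarrow> b - a \<le> B"
  shows "max_gap f \<le> B"
proof (cases "length (exponents f) \<le> 1")
  case True
  then show ?thesis by (simp add: max_gap_def)
next
  case False
  let ?S = "{exponents f ! Suc i - exponents f ! i | i. Suc i < length (exponents f)}"
  have "?S \<noteq> {}"
    using False by (auto intro!: exI[of _ 0])
  moreover have "x \<le> B" if "x \<in> ?S" for x
    using that assms by (auto simp: is_gap_iff_exponents)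
  ultimately have "Max ?S \<le> B"
    using finite_gaps[of f] by simp
  then show ?thesis
    using False by (simp add: max_gap_def Let_def)
qed

section \<open>Comparison of the maximum gaps\<close>

text \<open>Block 0 is a nonzero multiple of 1 / Phi_m. Its coefficients within one period are those
  of \<open>- \<psi>\<close>, which stop at \<open>m - totient m\<close>; the next nonzero one is at
  \<open>m\<close>, a repetition of index 0, and \<open>m < p\<close> keeps it inside the
  block.\<close>

lemma totient_le_max_gap:
  assumes "prime p" "coprime p m" "m > 0" "m < p"
  shows "totient m \<le> max_gap (cyclotomic (m * p))"
proof -
  obtain \<psi> where \<psi>: "degree \<psi> = m - totient m" "\<psi> \<noteq> 0"
    "\<And>n. n < m \<Longrightarrow> inv_coeff m n = - coeff \<psi> n"
    "\<And>n. inv_coeff m (n + m) = inv_coeff m n"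
    using inverse_cyclotomic_coeffs[OF assms(3)] by metis
  have \<phi>: "0 < totient m" "totient m \<le> m"
    using assms by (auto simp: totient_le)
  have cf: "coeff (cyclotomic (m * p)) n = coeff (cyclotomic m) 0 * inv_coeff m n" if "n < p" for n
    using coeff_cyclotomic_mult_prime[OF assms(1-3) that, of 0] by (simp add: block_def)
  have "inv_coeff m 0 \<noteq> 0"
    by (simp add: inv_coeff_def coeff_0_cyclotomic)
  then have "inv_coeff m m \<noteq> 0"
    using \<psi>(4)[of 0] by simp
  moreover have "inv_coeff m (m - totient m) \<noteq> 0"
    using \<psi> \<phi> by (metis diff_less assms(3) leading_coeff_0_iff neg_equal_0_iff_equal)
  moreover have "inv_coeff m n = 0" if "m - totient m < n" "n < m" for n
    using \<psi> that by (simp add: coeff_eq_0)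
  ultimately have "is_gap (cyclotomic (m * p)) (m - totient m) m"
    using \<phi> assms(4) coeff_0_cyclotomic[of m] by (auto simp: is_gap_def cf)
  from max_gap_ge[OF this] show ?thesis
    using \<phi> by simp
qed

text \<open>Each gap for \<open>p\<close> either has length at most \<open>totient m\<close>, which
  is covered by \<open>totient_le_max_gap\<close> for \<open>p'\<close>, or crosses a block border
  and then recurs with equal length for \<open>p'\<close>. Exchanging the primes gives
  equality.\<close>

lemma max_gap_cyclotomic_le:
  assumes m: "m > 0" and p: "prime p" "m < p" and p': "prime p'" "m < p'"
    and cong: "[p = p'] (mod m)"
  shows "max_gap (cyclotomic (m * p)) \<le> max_gap (cyclotomic (m * p'))"
proof (rule max_gap_le)
  fix a b assume gap: "is_gap (cyclotomic (m * p)) a b"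
  let ?\<phi> = "totient m"
  have \<phi>: "0 < ?\<phi>" "?\<phi> \<le> m"
    using m by (auto simp: totient_le)
  have cop: "coprime p m" "coprime p' m"
    using m p p' by (auto intro!: prime_imp_coprime dest: dvd_imp_le)
  have p0: "p > 0" "p' > 0" using p p' by auto
  note cf = coeff_cyclotomic_mult_prime[OF p(1) cop(1) m]
  note cf' = coeff_cyclotomic_mult_prime[OF p'(1) cop(2) m]
  have tot: "?\<phi> \<le> max_gap (cyclotomic (m * p'))"
    by (rule totient_le_max_gap[OF p'(1) cop(2) m p'(2)])
  have window: "\<exists>s. u \<le> s \<and> s < u + ?\<phi> \<and> block m p i s \<noteq> 0" if "i < ?\<phi>" for i u
    using block_nonzero[OF cop(1) m p0(1) that] block_eq_0_if_window[OF m, of u p i] by metis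
  define i s where "i = a div p" and "s = a mod p"
  define j t where "j = b div p" and "t = b mod p"
  have a: "a = i * p + s" "s < p" and b: "b = j * p + t" "t < p"
    using p0 by (auto simp: i_def s_def j_def t_def)
  have ab: "a < b" "block m p i s \<noteq> 0" "block m p j t \<noteq> 0"
    using gap cf[OF a(2), of i] cf[OF b(2), of j] by (auto simp: is_gap_def a b)
  have zero: "block m p k n = 0" if "a < k * p + n" "k * p + n < b" "n < p" for k n
    using gap that cf[OF that(3), of k] by (auto simp: is_gap_def)
  have "b \<le> degree (cyclotomic (m * p))"
    using gap by (auto simp: is_gap_def intro: le_degree)
  also have "\<dots> = ?\<phi> * (p - 1)"
    using p cop by (simp add: degree_cyclotomic totient_mult_coprime coprime_commute totient_prime)
  also have "\<dots> < ?\<phi> * p"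
    using \<phi> p0 by simp
  finally have "j < ?\<phi>"
    by (simp add: j_def less_mult_imp_div_less)
  have "i \<le> j"
    using ab(1) by (simp add: i_def j_def div_le_mono)
  show "b - a \<le> max_gap (cyclotomic (m * p'))"
  proof (cases "i = j")
    case True
    have "b - a \<le> ?\<phi>"
    proof (rule ccontr)
      assume "\<not> b - a \<le> ?\<phi>"
      then have *: "s + 1 + ?\<phi> \<le> t" using a b True ab(1) by auto
      obtain n where "s + 1 \<le> n" "n < s + 1 + ?\<phi>" "block m p i n \<noteq> 0"
        using window[of i "s + 1"] \<open>j < ?\<phi>\<close> True by auto
      then show False
        using zero[of i n] * a b True by auto
    qed
    then show ?thesis using tot by simp
  next
    case False
    then have "i < j" using \<open>i \<le> j\<close> by simp
    \<comment> \<open>No gap can skip a whole block: the first \<open>totient m\<close> entries of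
      block \<open>Suc i\<close> contain a nonzero one, and they fit since
      \<open>totient m \<le> m < p\<close>.\<close>
    have j: "j = Suc i"
    proof (rule ccontr)
      assume "j \<noteq> Suc i"
      then have "Suc i < j" using \<open>i < j\<close> by simp
      then have "Suc (Suc i) * p \<le> j * p" by (intro mult_le_mono1) simp
      obtain n where n: "n < ?\<phi>" "block m p (Suc i) n \<noteq> 0"
        using window[of "Suc i" 0] \<open>Suc i < j\<close> \<open>j < ?\<phi>\<close> by auto
      then have "n < p" using \<phi> p by simp
      then show False
        using zero[of "Suc i" n] n a b \<open>Suc (Suc i) * p \<le> j * p\<close> by auto
    qed
    \<comment> \<open>Otherwise a full window after \<open>s\<close> would fit into block
      \<open>i\<close> and interrupt the gap.\<close>
    have s: "p - ?\<phi> \<le> s"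
    proof (rule ccontr)
      assume "\<not> p - ?\<phi> \<le> s"
      then have *: "s + 1 + ?\<phi> \<le> p" by auto
      obtain n where "s + 1 \<le> n" "n < s + 1 + ?\<phi>" "block m p i n \<noteq> 0"
        using window[of i "s + 1"] \<open>j < ?\<phi>\<close> j by auto
      then show False
        using zero[of i n] * a b j by auto
    qed
    have t: "t < ?\<phi>"
    proof (rule ccontr)
      assume "\<not> t < ?\<phi>"
      obtain n where "n < ?\<phi>" "block m p j n \<noteq> 0"
        using window[of j 0] \<open>j < ?\<phi>\<close> by auto
      then show False
        using zero[of j n] \<open>\<not> t < ?\<phi>\<close> a b j by auto
    qed
    \<comment> \<open>\<open>s'\<close> has the same distance to the end of its block as
      \<open>s\<close>. The subtraction does not truncate, as
      \<open>p - s \<le> totient m < p'\<close>.\<close>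
    define s' where "s' = s + p' - p"
    have s': "s' + p = s + p'" "s' < p'"
      using s \<phi> p p' a by (auto simp: s'_def)
    have t': "t < p'" using t \<phi> p' by simp
    have shift: "block m p' i n' = block m p i n" if "n' + p = n + p'" for n n'
    proof (rule block_cong[OF m cong_sym[OF cong]])
      have "[n' + p = n + p] (mod m)"
        using that cong by (metis cong_add_lcancel_nat cong_sym)
      then show "[n' = n] (mod m)"
        by (simp add: cong_add_rcancel_nat)
    qed
    have same: "block m p' j n = block m p j n" for n
      by (rule block_cong[OF m cong_sym[OF cong] cong_refl])
    have "is_gap (cyclotomic (m * p')) (i * p' + s') (j * p' + t)"
      unfolding is_gap_def
    proof (intro conjI allI impI)
      show "i * p' + s' < j * p' + t"
        using s' j by simp
      show "coeff (cyclotomic (m * p')) (i * p' + s') \<noteq> 0"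
        using ab shift[OF s'(1)] by (simp add: cf'[OF s'(2)])
      show "coeff (cyclotomic (m * p')) (j * p' + t) \<noteq> 0"
        using ab same by (simp add: cf'[OF t'])
      fix n assume n: "i * p' + s' < n \<and> n < j * p' + t"
      show "coeff (cyclotomic (m * p')) n = 0"
      \<comment> \<open>Left of the border, positions are matched by their distance to the end of
        block \<open>i\<close>; right of it, by their distance to the start of block
        \<open>j\<close>.\<close>
      proof (cases "n < j * p'")
        case True
        define u' where "u' = n - i * p'"
        define u where "u = u' + p - p'"
        have u': "n = i * p' + u'" "s' < u'" "u' < p'"
          using n True j by (auto simp: u'_def)
        have u: "u' + p = u + p'" "s < u" "u < p"
          using u' s' by (auto simp: u_def)
        have "block m p i u = 0"
          using u a b j by (intro zero) auto
        then show ?thesis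
          using cf'[OF u'(3), of i] shift[OF u(1)] by (simp add: u'(1))
      next
        case False
        define u where "u = n - j * p'"
        have u: "n = j * p' + u" "u < t"
          using n False by (auto simp: u_def)
        have "block m p j u = 0"
          using u a b j by (intro zero) auto
        then show ?thesis
          using cf'[of u j] u t' same by simp
      qed
    qed
    from max_gap_ge[OF this] have "j * p' + t - (i * p' + s') \<le> max_gap (cyclotomic (m * p'))" .
    moreover have "j * p' + t - (i * p' + s') = b - a"
      using s' a b j by auto
    ultimately show ?thesis by simp
  qed
qed

theorem theorem7:
  fixes m p p' :: nat
  assumes "0 < m" and "odd m" and "squarefree m"
    and "prime p" and "prime p'"
    and "m < p" and "m < p'"
    and "p mod m = p' mod m"
  shows "max_gap (cyclotomic (m * p)) = max_gap (cyclotomic (m * p'))"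
  using assms max_gap_cyclotomic_le[of m p p'] max_gap_cyclotomic_le[of m p' p]
  by (auto simp: cong_def intro: antisym)

end
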